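(* Let $\mathbb{T}$ be a combinatorial tree forcing with the selective disjoint antichain property, and let $t^0$ be its tree ideal. Then $\mathrm{cf}(\mathrm{cof}(t^0))>\mathfrak{c}$.
   Context: For a tree $T\subseteq\omega^{<\omega}$, $[T]=\{x\in\omega^\omega: x\upharpoonright n\in T \text{ for all } n\}$. A collection $\mathbb{T}$ of subtrees of $\omega^{<\omega}$ is a combinatorial tree forcing if: (1) $\omega^{<\omega}\in\mathbb{T}$; (2) if $T\in\mathbb{T}$ and $s\in T$ then $T_s=\{t\in T: s\subseteq t \text{ or } t\subseteq s\}\in\mathbb{T}$; (3) there is a continuous $f:\omega^\omega\to 2^\omega$ such that for every $x\in 2^\omega$, $f^{-1}(\{x\})=[S]$ for some $S\in\mathbb{T}$; (4) (homogeneity) for every $T\in\mathbb{T}$ there is an order-preserving injection $i:\omega^{<\omega}\to T$ such that $g(x)=\bigcup_n i(x\upharpoonright n)$ defines a homeomorphism $g:\omega^\omega\to[T]$ and for any subtree $S\subseteq\omega^{<\omega}$, $S\in\mathbb{T}$ iff the downward closure of $i(S)$ is in $\mathbb{T}$. $\mathbb{T}$ is ordered by inclusion. The tree ideal $t^0$ consists of all $X\subseteq\omega^\omega$ such that for every $T\in\mathbb{T}$ there is $S\in\mathbb{T}$, $S\subseteq T$, with $X\cap[S]=\emptyset$. $\mathrm{cof}(t^0)$ is the least size of a family $\mathcal{J}\subseteq t^0$ such that every member of $t^0$ is contained in a member of $\mathcal{J}$; $\mathrm{cf}$ denotes cofinality of a cardinal; $\mathfrak{c}=2^{\aleph_0}$.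 $\mathbb{T}$ has the selective disjoint antichain property if there is an antichain $(T_\alpha:\alpha<\mathfrak{c})$ in $\mathbb{T}$ such that $[T_\alpha]\cap[T_\beta]=\emptyset$ for all $\alpha\neq\beta$, and for every $T\in\mathbb{T}$ there is $S\in\mathbb{T}$, $S\subseteq T$, such that either $S\subseteq T_\alpha$ for some $\alpha<\mathfrak{c}$, or $|[S]\cap[T_\alpha]|\le 1$ for all $\alpha<\mathfrak{c}$. *)

theory Defs
  imports "HOL-Analysis.Analysis" "HOL-Library.Sublist"
begin

unbundle cardinal_syntax

section \<open>Trees of finite sequences of natural numbers\<close>

definition is_tree :: "nat list set \<Rightarrow> bool" where
  "is_tree T \<longleftrightarrow> (\<forall>t\<in>T. \<forall>s. prefix s t \<longrightarrow> s \<in> T)"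

definition restr :: "(nat \<Rightarrow> nat) \<Rightarrow> nat \<Rightarrow> nat list" where
  "restr x n = map x [0..<n]"

definition body :: "nat list set \<Rightarrow> (nat \<Rightarrow> nat) set" where
  "body T = {x. \<forall>n. restr x n \<in> T}"

definition subtree_at :: "nat list set \<Rightarrow> nat list \<Rightarrow> nat list set" where
  "subtree_at T s = {t \<in> T. prefix s t \<or> prefix t s}"

definition down_closure :: "nat list set \<Rightarrow> nat list set" where
  "down_closure A = {s. \<exists>t\<in>A. prefix s t}"

text \<open>The union of the finite sequences in \<open>A\<close>, regarded as sets of pairs. It is meaningful when
  \<open>A\<close> is a chain under \<^const>\<open>prefix\<close> with unbounded lengths.\<close>

definition seq_Union :: "nat list set \<Rightarrow> (nat \<Rightarrow> nat)" where
  "seq_Union A = (\<lambda>k. THE m. \<exists>s\<in>A. k < length s \<and> s ! k = m)"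

text \<open>The types \<^typ>\<open>nat \<Rightarrow> nat\<close> and \<^typ>\<open>nat \<Rightarrow> bool\<close> carry the product of the discrete topologies,
  so they are Baire space and Cantor space.\<close>

definition combinatorial_tree_forcing :: "nat list set set \<Rightarrow> bool" where
  "combinatorial_tree_forcing \<T> \<longleftrightarrow>
     (\<forall>T\<in>\<T>. is_tree T) \<and>
     UNIV \<in> \<T> \<and>
     (\<forall>T\<in>\<T>. \<forall>s\<in>T. subtree_at T s \<in> \<T>) \<and>
     (\<exists>f :: (nat \<Rightarrow> nat) \<Rightarrow> (nat \<Rightarrow> bool).
        continuous_on UNIV f \<and> (\<forall>x. \<exists>S\<in>\<T>. f -` {x} = body S)) \<and>
     (\<forall>T\<in>\<T>. \<exists>i :: nat list \<Rightarrow> nat list.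
        range i \<subseteq> T \<and> inj i \<and> (\<forall>s t. prefix s t \<longrightarrow> prefix (i s) (i t)) \<and>
        (\<exists>g'. homeomorphism UNIV (body T) (\<lambda>x. seq_Union (range (\<lambda>n. i (restr x n)))) g') \<and>
        (\<forall>S. is_tree S \<longrightarrow> (S \<in> \<T> \<longleftrightarrow> down_closure (i ` S) \<in> \<T>)))"

definition tree_ideal :: "nat list set set \<Rightarrow> (nat \<Rightarrow> nat) set set" where
  "tree_ideal \<T> = {X. \<forall>T\<in>\<T>. \<exists>S\<in>\<T>. S \<subseteq> T \<and> X \<inter> body S = {}}"

section \<open>Cardinals\<close>

abbreviation continuum :: "(nat \<Rightarrow> bool) rel" where
  "continuum \<equiv> ctwo ^c natLeq"

definition least_card :: "('a set \<Rightarrow> bool) \<Rightarrow> 'a rel" where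
  "least_card P = |SOME A. P A \<and> (\<forall>B. P B \<longrightarrow> |A| \<le>o |B| )|"

lemma least_card:
  assumes "P B"
  shows "\<exists>A. P A \<and> least_card P = |A|" and "least_card P \<le>o |B|"
proof -
  have "\<exists>r\<in>card_of ` {A. P A}. \<forall>r'\<in>card_of ` {A. P A}. r \<le>o r'"
    using assms by (intro exists_minim_Card_order) (auto simp: card_of_Card_order)
  then have "\<exists>A. P A \<and> (\<forall>B. P B \<longrightarrow> |A| \<le>o |B| )" by auto
  then have *: "P (SOME A. P A \<and> (\<forall>B. P B \<longrightarrow> |A| \<le>o |B| )) \<and>
      (\<forall>B. P B \<longrightarrow> |SOME A. P A \<and> (\<forall>B. P B \<longrightarrow> |A| \<le>o |B| )| \<le>o |B| )"
    by (rule someI_ex)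
  show "\<exists>A. P A \<and> least_card P = |A|" using * unfolding least_card_def by blast
  show "least_card P \<le>o |B|" using * assms unfolding least_card_def by blast
qed

definition cof :: "'a set set \<Rightarrow> 'a set rel" where
  "cof I = least_card (\<lambda>J. J \<subseteq> I \<and> (\<forall>X\<in>I. \<exists>Y\<in>J. X \<subseteq> Y))"

text \<open>Unlike in \<^const>\<open>cofinal\<close>, the bound need not be strict, so that a cofinal subset exists
  for every well-order. For infinite cardinals the two notions agree.\<close>

definition cf :: "'a rel \<Rightarrow> 'a rel" where
  "cf r = least_card (\<lambda>A. A \<subseteq> Field r \<and> (\<forall>a\<in>Field r. \<exists>b\<in>A. (a, b) \<in> r))"

lemma cf_eq_cofinal:
  assumes r: "Card_order r" "infinite (Field r)"
  shows "cf r = least_card (\<lambda>A. A \<subseteq> Field r \<and> cofinal A r)"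
proof -
  have "(\<forall>a\<in>Field r. \<exists>b\<in>A. (a, b) \<in> r) \<longleftrightarrow> cofinal A r" for A
  proof
    assume *: "\<forall>a\<in>Field r. \<exists>b\<in>A. (a, b) \<in> r"
    have tr: "trans r" and an: "antisym r"
      using r(1) unfolding card_order_on_def well_order_on_def linear_order_on_def
        partial_order_on_def preorder_on_def by auto
    show "cofinal A r"
      unfolding cofinal_def
    proof
      fix a assume "a \<in> Field r"
      then obtain b where b: "a \<noteq> b" "(a, b) \<in> r"
        using infinite_Card_order_limit[OF r] by blast
      then have "b \<in> Field r" by (auto simp: Field_def)
      then obtain c where c: "c \<in> A" "(b, c) \<in> r" using * by blast
      have "(a, c) \<in> r" using tr b(2) c(2) by (rule transD)
      moreover have "a \<noteq> c" using an b c(2) by (auto dest: antisymD)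
      ultimately show "\<exists>c\<in>A. a \<noteq> c \<and> (a, c) \<in> r" using c(1) by blast
    qed
  qed (auto simp: cofinal_def)
  then show ?thesis unfolding cf_def by simp
qed

section \<open>The selective disjoint antichain property\<close>

text \<open>Antichains are meant in the forcing sense: distinct members have no common extension.
  The index set of size continuum is the field of the cardinal, whose order plays no role.\<close>

definition selective_disjoint_antichain_property :: "nat list set set \<Rightarrow> bool" where
  "selective_disjoint_antichain_property \<T> \<longleftrightarrow>
     (\<exists>A. (\<forall>\<alpha>\<in>Field continuum. A \<alpha> \<in> \<T>) \<and>
        (\<forall>\<alpha>\<in>Field continuum. \<forall>\<beta>\<in>Field continuum. \<alpha> \<noteq> \<beta> \<longrightarrow>
            \<not> (\<exists>S\<in>\<T>. S \<subseteq> A \<alpha> \<and> S \<subseteq> A \<beta>)) \<and>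
        (\<forall>\<alpha>\<in>Field continuum. \<forall>\<beta>\<in>Field continuum. \<alpha> \<noteq> \<beta> \<longrightarrow>
            body (A \<alpha>) \<inter> body (A \<beta>) = {}) \<and>
        (\<forall>T\<in>\<T>. \<exists>S\<in>\<T>. S \<subseteq> T \<and>
            ((\<exists>\<alpha>\<in>Field continuum. S \<subseteq> A \<alpha>) \<or>
             (\<forall>\<alpha>\<in>Field continuum. |body S \<inter> body (A \<alpha>)| \<le>o cone))))"

end

theory Submission
  imports Defs
begin

text \<open>Suppose that a cofinal \<open>J \<subseteq> t\<^sup>0\<close> of least size is the union of families \<open>J\<^sub>\<alpha>\<close>, \<open>\<alpha> < \<cc>\<close>, each
  of smaller size. By homogeneity some \<open>X\<^sub>\<alpha> \<subseteq> [T\<^sub>\<alpha>]\<close> in the ideal is not covered by any member of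
  \<open>J\<^sub>\<alpha>\<close>, even after removal of a set of fewer than \<open>\<cc>\<close> points, such sets being in \<open>t\<^sup>0\<close>. Enumerate
  the trees as \<open>S\<^sub>\<beta>\<close>, \<open>\<beta> < \<cc>\<close>, and remove from \<open>X\<^sub>\<alpha>\<close> the common point of \<open>[S\<^sub>\<beta>]\<close> and \<open>[T\<^sub>\<alpha>]\<close> for
  those \<open>\<beta> < \<alpha>\<close> for which \<open>S\<^sub>\<beta>\<close> meets every \<open>[T\<^sub>\<gamma>]\<close> in at most one point. Then the union of the
  \<open>X\<^sub>\<alpha>\<close> meets each such \<open>[S\<^sub>\<beta>]\<close> in fewer than \<open>\<cc>\<close> points, hence is in \<open>t\<^sup>0\<close>, although no member of
  \<open>J\<close> covers it.\<close>

section \<open>Cardinal arithmetic\<close>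

lemma continuum_eq: "continuum = |UNIV :: (nat \<Rightarrow> bool) set|"
  by (simp add: cexp_def ctwo_def Field_natLeq Field_card_of Func_def)

text \<open>An infinite cardinal has no largest element, so the closed segment up to
  \<open>a\<close> lies in the open segment below some larger \<open>b\<close>.\<close>

lemma card_of_under_ordLess:
  assumes "Card_order r" "infinite (Field r)" "a \<in> Field r"
  shows "|under r a| <o r"
proof -
  obtain b where b: "b \<in> Field r" "a \<noteq> b" "(a, b) \<in> r"
    using infinite_Card_order_limit[OF assms(1,2,3)] by (auto simp: Field_def)
  have "trans r" "antisym r"
    using assms(1) unfolding card_order_on_def well_order_on_def linear_order_on_def
      partial_order_on_def preorder_on_def by auto
  then have "under r a \<subseteq> underS r b"
    using b unfolding under_def underS_def by (auto dest: transD antisymD)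
  from ordLeq_ordLess_trans[OF card_of_mono1[OF this] card_of_underS[OF assms(1) b(1)]]
  show ?thesis .
qed

lemma ordLeq_cone_unique:
  assumes "|Q| \<le>o cone" "x \<in> Q" "y \<in> Q"
  shows "x = y"
proof -
  obtain f where "inj_on f Q" "f ` Q \<subseteq> {()}"
    using assms(1) unfolding BNF_Cardinal_Arithmetic.cone_def card_of_ordLeq[symmetric] by blast
  then show ?thesis using assms(2,3) by (simp add: inj_on_def)
qed

text \<open>This serves to enumerate all trees along the continuum.\<close>

lemma ex_surj_nat_list_sets: "\<exists>e :: (nat \<Rightarrow> bool) \<Rightarrow> nat list set. surj e"
proof (intro exI surjI)
  fix S :: "nat list set"
  show "{s. (\<lambda>n. from_nat n \<in> S) (to_nat s)} = S" by simp
qed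

lemma finite_ordLess_infinite_card:
  assumes "finite A" "infinite B"
  shows "|A| <o |B|"
proof (rule ordLess_ordLeq_trans)
  show "|A| <o natLeq" using assms(1) by (simp add: finite_iff_ordLess_natLeq)
  show "natLeq \<le>o |B|" using assms(2) infinite_iff_natLeq_ordLeq[of B] by blast
qed

section \<open>Initial segments and the topology of Baire space\<close>

lemma length_restr [simp]: "length (restr x n) = n"
  by (simp add: restr_def)

lemma take_restr: "m \<le> n \<Longrightarrow> take m (restr x n) = restr x m"
  by (simp add: restr_def take_map)

lemma prefix_restr_iff: "prefix s (restr x n) \<longleftrightarrow> length s \<le> n \<and> restr x (length s) = s"
proof
  assume s: "prefix s (restr x n)"
  then have "length s \<le> n" using prefix_length_le by fastforce
  moreover have "take (length s) (restr x n) = s" using s by (auto elim: prefixE)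
  ultimately show "length s \<le> n \<and> restr x (length s) = s" by (simp add: take_restr)
next
  assume "length s \<le> n \<and> restr x (length s) = s"
  then have "s = take (length s) (restr x n)" by (simp add: take_restr)
  then show "prefix s (restr x n)" using take_is_prefix by metis
qed

lemma restr_eq_iff: "restr x n = restr y n \<longleftrightarrow> (\<forall>k<n. x k = y k)"
  by (auto simp: restr_def)

lemma restr_eq_mono: "restr x n = restr y n \<Longrightarrow> m \<le> n \<Longrightarrow> restr x m = restr y m"
  by (metis take_restr)

lemma ex_restr_eq: "\<exists>x. restr x (length s) = s"
  by (rule exI[of _ "\<lambda>k. s ! k"]) (simp add: restr_def map_nth)

lemma open_restr: "open {z. restr z m = restr x m}"
proof -
  have "{z. restr z m = restr x m} = (\<Inter>k\<in>{..<m}. (\<lambda>z. z k) -` {x k})"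
    by (auto simp: restr_eq_iff)
  moreover have "open ((\<lambda>z::nat \<Rightarrow> nat. z k) -` {x k})" for k
    by (intro open_vimage continuous_on_product_coordinates open_discrete)
  ultimately show ?thesis by auto
qed

lemma open_contains_restr:
  assumes "open V" "y \<in> V"
  shows "\<exists>n. \<forall>w. restr w n = restr y n \<longrightarrow> w \<in> V"
proof -
  have "openin (product_topology (\<lambda>_. euclidean) UNIV) V"
    using assms(1) by (simp add: open_fun_def)
  from product_topology_open_contains_basis[OF this assms(2)]
  obtain X where X: "y \<in> Pi\<^sub>E UNIV X" "finite {k. X k \<noteq> UNIV}" "Pi\<^sub>E UNIV X \<subseteq> V"
    by auto
  obtain n where n: "\<And>k. X k \<noteq> UNIV \<Longrightarrow> k < n"
    using X(2) finite_nat_set_iff_bounded by auto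
  have "w \<in> V" if "restr w n = restr y n" for w
  proof -
    have "w k \<in> X k" for k
    proof (cases "X k = UNIV")
      case False
      then have "w k = y k" using n that by (simp add: restr_eq_iff)
      then show ?thesis using X(1) by (auto simp: PiE_def)
    qed auto
    then show ?thesis using X(3) by auto
  qed
  then show ?thesis by blast
qed

lemma is_treeD: "is_tree T \<Longrightarrow> t \<in> T \<Longrightarrow> prefix s t \<Longrightarrow> s \<in> T"
  unfolding is_tree_def by blast

section \<open>Tree embeddings\<close>

locale tree_embedding =
  fixes T :: "nat list set" and i :: "nat list \<Rightarrow> nat list" and g g' :: "(nat \<Rightarrow> nat) \<Rightarrow> nat \<Rightarrow> nat"
  assumes tree: "is_tree T"
    and range_i: "range i \<subseteq> T"
    and inj_i: "inj i"
    and mono_i: "prefix s t \<Longrightarrow> prefix (i s) (i t)"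
    and g_def: "g = (\<lambda>x. seq_Union (range (\<lambda>n. i (restr x n))))"
    and homeo: "homeomorphism UNIV (body T) g g'"
begin

lemma prefix_i_restr: "m \<le> n \<Longrightarrow> prefix (i (restr x m)) (i (restr x n))"
  by (intro mono_i) (simp add: prefix_restr_iff)

text \<open>Injectivity makes each extension along a branch strict, so every step adds at least one
  entry.\<close>

lemma length_i_restr: "n \<le> length (i (restr x n))"
proof (induction n)
  case (Suc n)
  have "restr x n \<noteq> restr x (Suc n)" by (metis length_restr n_not_Suc_n)
  then have "i (restr x n) \<noteq> i (restr x (Suc n))" using inj_i by (simp add: inj_eq)
  then have "strict_prefix (i (restr x n)) (i (restr x (Suc n)))"
    using prefix_i_restr[of n "Suc n" x] by (auto simp: strict_prefix_def)
  then show ?case using Suc prefix_length_less by fastforce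
qed simp

text \<open>The images along a branch are pairwise comparable, hence agree wherever both are
  defined; so the definite description in \<open>seq_Union\<close> has a unique value.\<close>

lemma restr_g: "restr (g x) (length (i (restr x n))) = i (restr x n)"
proof -
  have "g x k = i (restr x n) ! k" if k: "k < length (i (restr x n))" for k
  proof -
    have "i (restr x m) ! k = i (restr x n) ! k" if "k < length (i (restr x m))" for m
      using prefix_i_restr[of m n x] prefix_i_restr[of n m x] k that
      by (cases "m \<le> n") (auto simp: prefix_def nth_append)
    then show ?thesis
      unfolding g_def seq_Union_def using k by (intro the_equality) blast+
  qed
  then show ?thesis by (intro nth_equalityI) (simp_all add: restr_def)
qed

lemma prefix_restr_g: "\<exists>m. prefix (restr (g x) n) (i (restr x m))"
  by (rule exI[of _ n], subst restr_g[symmetric]) (simp add: prefix_restr_iff length_i_restr)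

lemma g_in_body_iff:
  assumes "is_tree R"
  shows "g x \<in> body R \<longleftrightarrow> (\<forall>n. i (restr x n) \<in> R)"
proof
  show "\<forall>n. i (restr x n) \<in> R" if "g x \<in> body R"
    using that restr_g unfolding body_def by (metis mem_Collect_eq)
  show "g x \<in> body R" if "\<forall>n. i (restr x n) \<in> R"
    using that prefix_restr_g is_treeD[OF assms] unfolding body_def by blast
qed

lemma inj_g: "inj g"
  using homeo unfolding homeomorphism_def by (metis UNIV_I injI)

lemma range_g: "range g = body T"
  using homeo by (simp add: homeomorphism_def)

lemma is_tree_down_closure: "is_tree (down_closure A)"
  unfolding is_tree_def down_closure_def using prefix_order.trans by blast

lemma down_closure_subset: "down_closure (i ` S) \<subseteq> T"
  unfolding down_closure_def using range_i tree is_treeD by blast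

text \<open>The inclusion from left to right is the harder one: a priori, the initial segments of a
  branch may come from unrelated elements of \<open>S\<close>. Continuity of \<open>g'\<close> makes
  these elements follow the preimage branch up to any prescribed length.\<close>

lemma body_down_closure:
  assumes S: "is_tree S"
  shows "body (down_closure (i ` S)) = g ` body S"
proof
  show "g ` body S \<subseteq> body (down_closure (i ` S))"
  proof
    fix y assume "y \<in> g ` body S"
    then obtain x where x: "y = g x" "x \<in> body S" by blast
    have "i (restr x n) \<in> down_closure (i ` S)" for n
      using x(2) unfolding body_def down_closure_def by blast
    then show "y \<in> body (down_closure (i ` S))"
      using g_in_body_iff is_tree_down_closure x(1) by blast
  qed
  show "body (down_closure (i ` S)) \<subseteq> g ` body S"
  proof
    fix y assume y: "y \<in> body (down_closure (i ` S))"
    then have "y \<in> body T" using down_closure_subset unfolding body_def by blast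
    then obtain x where x: "y = g x" using range_g by blast
    have "restr x m \<in> S" for m
    proof -
      have "continuous_on (body T) g'" using homeo by (simp add: homeomorphism_def)
      then obtain V where V: "open V" "V \<inter> body T = g' -` {z. restr z m = restr x m} \<inter> body T"
        using open_restr[of m x] continuous_on_open_invariant[THEN iffD1, rule_format] by metis
      have g'g: "g' (g z) = z" for z using homeo by (simp add: homeomorphism_def)
      have "g' y \<in> {z. restr z m = restr x m}" by (simp add: x g'g)
      then have "y \<in> V" using V(2) \<open>y \<in> body T\<close> by blast
      then obtain n where n: "\<forall>w. restr w n = restr y n \<longrightarrow> w \<in> V"
        using open_contains_restr[OF V(1)] by meson
      \<comment> \<open>Beyond \<open>n\<close>, the initial segment of \<open>y\<close> forces
        membership in \<open>V\<close>; beyond the length of \<open>i (restr x m)\<close>, it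
        excludes a \<open>t\<close> too short to extend \<open>restr x m\<close>.\<close>
      define N where "N = Suc (n + length (i (restr x m)))"
      obtain t where t: "t \<in> S" "prefix (restr y N) (i t)"
        using y unfolding body_def down_closure_def by blast
      obtain z where z: "restr z (length t) = t" using ex_restr_eq[of t] by blast
      have "restr (g z) (length (i t)) = i t" using restr_g[of z "length t"] z by simp
      then have "prefix (restr y N) (restr (g z) (length (i t)))" using t(2) by simp
      then have "restr (g z) N = restr y N" by (simp add: prefix_restr_iff)
      then have "g z \<in> V" by (intro n[rule_format]) (auto intro: restr_eq_mono simp: N_def)
      then have "g z \<in> V \<inter> body T" using range_g by blast
      then have zx: "restr z m = restr x m" unfolding V(2) by (simp add: g'g)
      show ?thesis
      proof (cases "m \<le> length t")
        case True
        then have "prefix (restr x m) t" 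
          using zx z take_restr[of m "length t" z] take_is_prefix[of m t] by simp
        then show ?thesis using S t(1) is_treeD by blast
      next
        \<comment> \<open>A short \<open>t\<close> is an initial segment of \<open>restr x m\<close>, so \<open>i t\<close> would be too short.\<close>
        case False
        then have "t = restr x (length t)" 
          using zx z restr_eq_mono[of z m x "length t"] by simp
        then have "prefix (i t) (i (restr x m))" 
          using False prefix_i_restr[of "length t" m x] by simp
        then have "length (i t) < N" unfolding N_def using prefix_length_le by fastforce
        then show ?thesis using t(2) prefix_length_le by fastforce
      qed
    qed
    then show "y \<in> g ` body S" using x unfolding body_def by blast
  qed
qed

end

section \<open>Combinatorial tree forcings\<close>

locale tree_forcing =
  fixes \<T> :: "nat list set set"
  assumes forcing: "combinatorial_tree_forcing \<T>"
begin

lemma is_tree: "T \<in> \<T> \<Longrightarrow> is_tree T"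
  using forcing unfolding combinatorial_tree_forcing_def by blast

end

locale homogeneous_embedding = tree_forcing \<T> + tree_embedding T i g g'
  for \<T> T i g g' +
  assumes down_closure_iff: "is_tree S \<Longrightarrow> S \<in> \<T> \<longleftrightarrow> down_closure (i ` S) \<in> \<T>"

context tree_forcing
begin

lemma ex_homogeneous_embedding:
  assumes T: "T \<in> \<T>"
  shows "\<exists>i g g'. homogeneous_embedding \<T> T i g g'"
proof -
  have "\<forall>T\<in>\<T>. \<exists>i :: nat list \<Rightarrow> nat list.
        range i \<subseteq> T \<and> inj i \<and> (\<forall>s t. prefix s t \<longrightarrow> prefix (i s) (i t)) \<and>
        (\<exists>g'. homeomorphism UNIV (body T) (\<lambda>x. seq_Union (range (\<lambda>n. i (restr x n)))) g') \<and>
        (\<forall>S. is_tree S \<longrightarrow> (S \<in> \<T> \<longleftrightarrow> down_closure (i ` S) \<in> \<T>))"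
    using forcing unfolding combinatorial_tree_forcing_def by (elim conjE) assumption
  from bspec[OF this T] obtain i g' where i: "range i \<subseteq> T" "inj i"
    "\<forall>s t. prefix s t \<longrightarrow> prefix (i s) (i t)"
    "homeomorphism UNIV (body T) (\<lambda>x. seq_Union (range (\<lambda>n. i (restr x n)))) g'"
    "\<forall>S. is_tree S \<longrightarrow> (S \<in> \<T> \<longleftrightarrow> down_closure (i ` S) \<in> \<T>)"
    by (elim exE conjE) rule
  have "homogeneous_embedding \<T> T i (\<lambda>x. seq_Union (range (\<lambda>n. i (restr x n)))) g'"
    using i is_tree[OF T] by unfold_locales auto
  then show ?thesis by blast
qed

lemma body_nonempty:
  assumes "T \<in> \<T>"
  shows "body T \<noteq> {}"
proof -
  obtain i g g' where emb: "homogeneous_embedding \<T> T i g g'"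
    using ex_homogeneous_embedding[OF assms] by blast
  interpret homogeneous_embedding \<T> T i g g' by (rule emb)
  show ?thesis using range_g by blast
qed

text \<open>The part of \<open>T\<close> comparable with \<open>s\<close> is again in the forcing,
  so it has a branch, and this must pass through \<open>s\<close>.\<close>

lemma branch_through:
  assumes "T \<in> \<T>" "s \<in> T"
  shows "\<exists>x\<in>body T. restr x (length s) = s"
proof -
  have "\<forall>T\<in>\<T>. \<forall>s\<in>T. subtree_at T s \<in> \<T>"
    using forcing unfolding combinatorial_tree_forcing_def by (elim conjE) assumption
  then have "subtree_at T s \<in> \<T>" using assms by blast
  then obtain x where x: "x \<in> body (subtree_at T s)" using body_nonempty by blast
  then have "prefix s (restr x (length s)) \<or> prefix (restr x (length s)) s"
    by (auto simp: body_def subtree_at_def)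
  then have "prefix s (restr x (length s))"
    using prefix_length_prefix[of s s "restr x (length s)"] by auto
  then have "restr x (length s) = s" by (simp add: prefix_restr_iff)
  moreover have "x \<in> body T" using x by (auto simp: body_def subtree_at_def)
  ultimately show ?thesis by blast
qed

section \<open>Closure properties of the tree ideal\<close>

lemma tree_idealD:
  assumes "X \<in> tree_ideal \<T>" "T \<in> \<T>"
  shows "\<exists>S\<in>\<T>. S \<subseteq> T \<and> X \<inter> body S = {}"
  using assms unfolding tree_ideal_def by blast

lemma tree_ideal_Un:
  assumes "X \<in> tree_ideal \<T>" "Y \<in> tree_ideal \<T>"
  shows "X \<union> Y \<in> tree_ideal \<T>"
  unfolding tree_ideal_def
proof safe
  fix T assume "T \<in> \<T>"
  then obtain S where S: "S \<in> \<T>" "S \<subseteq> T" "X \<inter> body S = {}"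
    using tree_idealD[OF assms(1)] by blast
  obtain R where R: "R \<in> \<T>" "R \<subseteq> S" "Y \<inter> body R = {}"
    using tree_idealD[OF assms(2) S(1)] by blast
  have "body R \<subseteq> body S" using R(2) by (auto simp: body_def)
  then show "\<exists>S\<in>\<T>. S \<subseteq> T \<and> (X \<union> Y) \<inter> body S = {}" using S R by blast
qed

text \<open>The fibres of \<open>f\<close>, transported below \<open>T\<close> by homogeneity, yield
  continuum many trees with pairwise disjoint bodies. If \<open>Z\<close> met all of them, choosing
  a point in each would inject Cantor space into \<open>Z\<close>.\<close>

lemma small_in_tree_ideal:
  assumes "|Z| <o |UNIV :: (nat \<Rightarrow> bool) set|"
  shows "Z \<in> tree_ideal \<T>"
  unfolding tree_ideal_def
proof safe
  fix T assume "T \<in> \<T>"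
  then obtain i g g' where emb: "homogeneous_embedding \<T> T i g g'"
    using ex_homogeneous_embedding by blast
  interpret homogeneous_embedding \<T> T i g g' by (rule emb)
  have "\<exists>f :: (nat \<Rightarrow> nat) \<Rightarrow> (nat \<Rightarrow> bool).
      continuous_on UNIV f \<and> (\<forall>x. \<exists>S\<in>\<T>. f -` {x} = body S)"
    using forcing unfolding combinatorial_tree_forcing_def by (elim conjE) assumption
  then obtain f :: "(nat \<Rightarrow> nat) \<Rightarrow> (nat \<Rightarrow> bool)" where "\<forall>x. \<exists>S\<in>\<T>. f -` {x} = body S"
    by blast
  then obtain F where F: "\<And>x. F x \<in> \<T>" "\<And>x. f -` {x} = body (F x)" by metis
  have R: "down_closure (i ` F x) \<in> \<T>" for x using down_closure_iff is_tree F(1) by blast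
  show "\<exists>S\<in>\<T>. S \<subseteq> T \<and> Z \<inter> body S = {}"
  proof (rule ccontr)
    assume "\<not> ?thesis"
    then have "\<exists>z. z \<in> Z \<and> z \<in> g ` body (F x)" for x
      using R[of x] down_closure_subset[of "F x"] body_down_closure[OF is_tree[OF F(1)[of x]]]
      by auto
    then have "\<exists>w. \<forall>x. w x \<in> Z \<and> w x \<in> g ` body (F x)" by (intro choice allI)
    then obtain w where w: "\<And>x. w x \<in> Z" "\<And>x. w x \<in> g ` body (F x)" by blast
    have "inj w"
    proof
      fix x y assume eq: "w x = w y"
      have "\<exists>a. w z = g a \<and> f a = z" for z using w(2)[of z] unfolding F(2)[symmetric] by auto
      then obtain a b where "w x = g a" "f a = x" "w y = g b" "f b = y" by blast
      then show "x = y" using eq by (auto simp: inj_eq[OF inj_g])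
    qed
    then have "|UNIV :: (nat \<Rightarrow> bool) set| \<le>o |Z|"
      using w(1) by (intro card_of_ordLeqI[of w]) auto
    then show False using not_ordLess_ordLeq[OF assms] by contradiction
  qed
qed

lemma finite_in_tree_ideal: "finite Z \<Longrightarrow> Z \<in> tree_ideal \<T>"
proof -
  assume "finite Z"
  moreover have "infinite (UNIV :: (nat \<Rightarrow> bool) set)" by (simp add: finite_UNIV_fun)
  ultimately show ?thesis by (intro small_in_tree_ideal finite_ordLess_infinite_card)
qed

lemma finite_Union_in_tree_ideal:
  "finite J \<Longrightarrow> J \<subseteq> tree_ideal \<T> \<Longrightarrow> \<Union>J \<in> tree_ideal \<T>"
  by (induction J rule: finite_induct) (simp_all add: tree_ideal_Un finite_in_tree_ideal)

lemma UNIV_notin_tree_ideal: "UNIV \<notin> tree_ideal \<T>"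
proof
  assume "UNIV \<in> tree_ideal \<T>"
  moreover have "UNIV \<in> \<T>" using forcing unfolding combinatorial_tree_forcing_def by blast
  ultimately obtain S where "S \<in> \<T>" "UNIV \<inter> body S = {}" using tree_idealD by blast
  then show False using body_nonempty by blast
qed

text \<open>The union of a finite family would be in the ideal, yet contain every singleton and so
  be the whole space.\<close>

lemma infinite_cofinal_family:
  assumes "J \<subseteq> tree_ideal \<T>" "\<forall>X\<in>tree_ideal \<T>. \<exists>Y\<in>J. X \<subseteq> Y"
  shows "infinite J"
proof
  assume "finite J"
  then have "\<Union>J \<in> tree_ideal \<T>" using assms(1) finite_Union_in_tree_ideal by blast
  moreover have "x \<in> \<Union>J" for x
    using assms(2) finite_in_tree_ideal[of "{x}"] by blast
  ultimately show False using UNIV_notin_tree_ideal by (metis UNIV_eq_I)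
qed

end

section \<open>Transport of the ideal along a homogeneous embedding\<close>

context homogeneous_embedding
begin

text \<open>Every tree of the forcing below \<open>T\<close> thus arises from \<open>i\<close>: a
  node of \<open>R\<close> lies on a branch \<open>g x\<close> of \<open>R\<close>, and some
  \<open>i (restr x m)\<close> in \<open>R\<close> extends it.\<close>

lemma pullback_tree:
  assumes R: "R \<in> \<T>" "R \<subseteq> T"
  shows "{s. i s \<in> R} \<in> \<T>" and "down_closure (i ` {s. i s \<in> R}) = R"
proof -
  have tR: "is_tree R" using R is_tree by blast
  show eq: "down_closure (i ` {s. i s \<in> R}) = R"
  proof
    show "down_closure (i ` {s. i s \<in> R}) \<subseteq> R"
      using tR is_treeD unfolding down_closure_def by blast
    show "R \<subseteq> down_closure (i ` {s. i s \<in> R})"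
    proof
      fix r assume "r \<in> R"
      then obtain y where y: "y \<in> body R" "restr y (length r) = r"
        using branch_through R(1) by blast
      have "y \<in> body T" using y(1) R(2) by (auto simp: body_def)
      then obtain x where x: "y = g x" using range_g by blast
      obtain m where "prefix r (i (restr x m))" using prefix_restr_g x y(2) by metis
      moreover have "i (restr x m) \<in> R" using y(1) x g_in_body_iff[OF tR] by blast
      ultimately show "r \<in> down_closure (i ` {s. i s \<in> R})" unfolding down_closure_def by blast
    qed
  qed
  have "is_tree {s. i s \<in> R}" using tR mono_i is_treeD unfolding is_tree_def by blast
  then show "{s. i s \<in> R} \<in> \<T>" using down_closure_iff eq R(1) by simp
qed

lemma body_pullback:
  assumes "R \<in> \<T>" "R \<subseteq> T"
  shows "body R = g ` body {s. i s \<in> R}"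
  using body_down_closure[OF is_tree[OF pullback_tree(1)[OF assms]]] pullback_tree(2)[OF assms]
  by simp

text \<open>To avoid the preimage inside \<open>S\<close>, avoid \<open>Y\<close> inside the closure
  of the image of \<open>S\<close> and pull the tree found there back along
  \<open>i\<close>.\<close>

lemma pullback_in_tree_ideal:
  assumes Y: "Y \<in> tree_ideal \<T>"
  shows "g -` Y \<in> tree_ideal \<T>"
  unfolding tree_ideal_def
proof safe
  fix S assume S: "S \<in> \<T>"
  then have "down_closure (i ` S) \<in> \<T>" using down_closure_iff is_tree by blast
  then obtain R where R: "R \<in> \<T>" "R \<subseteq> down_closure (i ` S)" "Y \<inter> body R = {}"
    using tree_idealD[OF Y] by blast
  have RT: "R \<subseteq> T" using R(2) down_closure_subset by blast
  let ?S = "{s. i s \<in> R}"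
  \<comment> \<open>\<open>i s \<subseteq> i t\<close> need not imply \<open>s \<subseteq> t\<close>, so one has to go through the branches.\<close>
  have "?S \<subseteq> S"
  proof
    fix s assume "s \<in> ?S"
    then obtain x where x: "x \<in> body ?S" "restr x (length s) = s"
      using branch_through pullback_tree(1)[OF R(1) RT] by blast
    then have "g x \<in> body R" using body_pullback[OF R(1) RT] by blast
    then have "g x \<in> body (down_closure (i ` S))" using R(2) by (auto simp: body_def)
    then have "x \<in> body S"
      using body_down_closure[OF is_tree[OF S]] inj_g by (auto dest: injD)
    then show "s \<in> S" using x(2) unfolding body_def by (metis mem_Collect_eq)
  qed
  moreover have "g -` Y \<inter> body ?S = {}" using R(3) body_pullback[OF R(1) RT] by blast
  ultimately show "\<exists>S'\<in>\<T>. S' \<subseteq> S \<and> g -` Y \<inter> body S' = {}"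
    using pullback_tree(1)[OF R(1) RT] by blast
qed

text \<open>The transport in the other direction: pull \<open>R\<close> back, shrink the result to
  avoid \<open>X\<close>, and push forward. It concerns trees below \<open>T\<close>, since these
  are the ones that \<open>pullback_tree\<close> represents through \<open>i\<close>.\<close>

lemma image_avoidable:
  assumes X: "X \<in> tree_ideal \<T>" and R: "R \<in> \<T>" "R \<subseteq> T"
  shows "\<exists>S\<in>\<T>. S \<subseteq> R \<and> g ` X \<inter> body S = {}"
proof -
  obtain S where S: "S \<in> \<T>" "S \<subseteq> {s. i s \<in> R}" "X \<inter> body S = {}"
    using tree_idealD[OF X pullback_tree(1)[OF R]] by blast
  have "down_closure (i ` S) \<in> \<T>" using down_closure_iff is_tree S(1) by blast
  moreover have "down_closure (i ` S) \<subseteq> R"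
    using S(2) is_tree[OF R(1)] is_treeD unfolding down_closure_def by blast
  moreover have "g ` X \<inter> body (down_closure (i ` S)) = {}"
    using S(3) inj_g body_down_closure[OF is_tree[OF S(1)]] by (auto dest: injD)
  ultimately show ?thesis by blast
qed

end

context tree_forcing
begin

text \<open>Homogeneity makes the ideal on \<open>[T]\<close> as hard to dominate as the whole ideal, and this is
  not affected by the removal of the fixed small set \<open>D\<close>.\<close>

lemma undominated_set:
  assumes T: "T \<in> \<T>" and D: "D \<in> tree_ideal \<T>"
    and F: "F \<subseteq> tree_ideal \<T>" "|F| <o cof (tree_ideal \<T>)"
  shows "\<exists>X\<subseteq>body T - D. (\<forall>Y\<in>F. \<not> X \<subseteq> Y) \<and>
    (\<forall>R\<in>\<T>. R \<subseteq> T \<longrightarrow> (\<exists>S\<in>\<T>. S \<subseteq> R \<and> X \<inter> body S = {}))"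
proof -
  obtain i g g' where emb: "homogeneous_embedding \<T> T i g g'"
    using ex_homogeneous_embedding[OF T] by blast
  interpret homogeneous_embedding \<T> T i g g' by (rule emb)
  \<comment> \<open>The image of \<open>X\<close> without \<open>D\<close> lies in \<open>Y\<close>
    iff \<open>X\<close> lies in the preimage of \<open>Y \<union> D\<close>. So it suffices to
    escape these preimages, which are too few to be cofinal in the ideal.\<close>
  let ?G = "(\<lambda>Y. g -` (Y \<union> D)) ` F"
  have sub: "?G \<subseteq> tree_ideal \<T>"
    using F(1) D by (blast intro: pullback_in_tree_ideal tree_ideal_Un)
  have "\<not> cof (tree_ideal \<T>) \<le>o |?G|"
    using ordLeq_ordLess_trans[OF card_of_image F(2)] by (rule not_ordLess_ordLeq)
  then have "\<not> (?G \<subseteq> tree_ideal \<T> \<and> (\<forall>X\<in>tree_ideal \<T>. \<exists>Y\<in>?G. X \<subseteq> Y))"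
    unfolding cof_def using least_card(2) by (rule contrapos_nn)
  then have "\<not> (\<forall>X\<in>tree_ideal \<T>. \<exists>Y\<in>?G. X \<subseteq> Y)" using sub by simp
  then obtain X where X: "X \<in> tree_ideal \<T>" "\<forall>Y\<in>F. \<not> X \<subseteq> g -` (Y \<union> D)"
    by auto
  have "g ` X - D \<subseteq> body T - D" using range_g by blast
  moreover have "\<forall>Y\<in>F. \<not> g ` X - D \<subseteq> Y" using X(2) by blast
  moreover have "\<forall>R\<in>\<T>. R \<subseteq> T \<longrightarrow> (\<exists>S\<in>\<T>. S \<subseteq> R \<and> (g ` X - D) \<inter> body S = {})"
  proof (intro ballI impI)
    fix R assume "R \<in> \<T>" "R \<subseteq> T"
    from image_avoidable[OF X(1) this]
    show "\<exists>S\<in>\<T>. S \<subseteq> R \<and> (g ` X - D) \<inter> body S = {}" by blast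
  qed
  ultimately show ?thesis by (intro exI[of _ "g ` X - D"] conjI)
qed

end

section \<open>The cofinality of the tree ideal\<close>

text \<open>One set escapes all families at once, because its part inside
  \<open>body (A \<alpha>)\<close> already escapes \<open>F \<alpha>\<close>. These parts are
  thinned so that their union stays in the ideal.\<close>

lemma (in tree_forcing) diagonal_union:
  fixes A :: "(nat \<Rightarrow> bool) \<Rightarrow> nat list set" and F :: "(nat \<Rightarrow> bool) \<Rightarrow> (nat \<Rightarrow> nat) set set"
  assumes A: "\<And>\<alpha>. A \<alpha> \<in> \<T>"
    and disj: "\<And>\<alpha> \<beta>. \<alpha> \<noteq> \<beta> \<Longrightarrow> body (A \<alpha>) \<inter> body (A \<beta>) = {}"
    and sel: "\<And>T. T \<in> \<T> \<Longrightarrow> \<exists>S\<in>\<T>. S \<subseteq> T \<and>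
      ((\<exists>\<alpha>. S \<subseteq> A \<alpha>) \<or> (\<forall>\<alpha>. |body S \<inter> body (A \<alpha>)| \<le>o cone))"
    and F: "\<And>\<alpha>. F \<alpha> \<subseteq> tree_ideal \<T>" "\<And>\<alpha>. |F \<alpha>| <o cof (tree_ideal \<T>)"
  shows "\<exists>X\<in>tree_ideal \<T>. \<forall>\<alpha>. \<forall>Y\<in>F \<alpha>. \<not> X \<subseteq> Y"
proof -
  let ?r = "|UNIV :: (nat \<Rightarrow> bool) set|"
  have inf: "infinite (Field ?r)" by (simp add: Field_card_of finite_UNIV_fun)
  obtain e :: "(nat \<Rightarrow> bool) \<Rightarrow> nat list set" where "surj e"
    using ex_surj_nat_list_sets by blast
  \<comment> \<open>The choice is arbitrary if the intersection is empty or has several points. This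
    is harmless: \<open>D \<alpha>\<close> only has to be small, and \<open>p\<close> is evaluated
    in earnest only where the intersection is a single point.\<close>
  define p where "p \<alpha> S = (SOME y. y \<in> body S \<inter> body (A \<alpha>))" for \<alpha> S
  define D where "D \<alpha> = (\<lambda>\<beta>. p \<alpha> (e \<beta>)) ` underS ?r \<alpha>" for \<alpha>
  have "D \<alpha> \<in> tree_ideal \<T>" for \<alpha>
    unfolding D_def
    by (intro small_in_tree_ideal ordLeq_ordLess_trans[OF card_of_image] card_of_underS)
      (simp_all add: card_of_card_order_on Field_card_of)
  then have "\<exists>X\<subseteq>body (A \<alpha>) - D \<alpha>. (\<forall>Y\<in>F \<alpha>. \<not> X \<subseteq> Y) \<and>
    (\<forall>R\<in>\<T>. R \<subseteq> A \<alpha> \<longrightarrow> (\<exists>S\<in>\<T>. S \<subseteq> R \<and> X \<inter> body S = {}))" for \<alpha>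
    by (intro undominated_set A F)
  then obtain X where X: "\<And>\<alpha>. X \<alpha> \<subseteq> body (A \<alpha>) - D \<alpha>" "\<And>\<alpha> Y. Y \<in> F \<alpha> \<Longrightarrow> \<not> X \<alpha> \<subseteq> Y"
    "\<And>\<alpha> R. R \<in> \<T> \<Longrightarrow> R \<subseteq> A \<alpha> \<Longrightarrow> \<exists>S\<in>\<T>. S \<subseteq> R \<and> X \<alpha> \<inter> body S = {}"
    by metis
  have "(\<Union>\<alpha>. X \<alpha>) \<in> tree_ideal \<T>"
    unfolding tree_ideal_def
  proof safe
    fix T assume "T \<in> \<T>"
    then obtain S where S: "S \<in> \<T>" "S \<subseteq> T"
      "(\<exists>\<alpha>. S \<subseteq> A \<alpha>) \<or> (\<forall>\<alpha>. |body S \<inter> body (A \<alpha>)| \<le>o cone)"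
      using sel by blast
    have "\<exists>R\<in>\<T>. R \<subseteq> S \<and> (\<Union>\<alpha>. X \<alpha>) \<inter> body R = {}"
      using S(3)
    proof
      assume "\<exists>\<alpha>. S \<subseteq> A \<alpha>"
      then obtain \<alpha> where \<alpha>: "S \<subseteq> A \<alpha>" by blast
      then obtain R where R: "R \<in> \<T>" "R \<subseteq> S" "X \<alpha> \<inter> body R = {}" using X(3)[OF S(1)] by blast
      have "body R \<subseteq> body (A \<alpha>)" using R(2) \<alpha> by (auto simp: body_def)
      \<comment> \<open>Inside \<open>body (A \<alpha>)\<close> disjointness leaves only
        \<open>X \<alpha>\<close> to be avoided.\<close>
      then have "X \<beta> \<inter> body R = {}" for \<beta>
        using R(3) X(1)[of \<beta>] disj[of \<alpha> \<beta>] by (cases "\<alpha> = \<beta>") auto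
      then show ?thesis using R by blast
    next
      assume one: "\<forall>\<alpha>. |body S \<inter> body (A \<alpha>)| \<le>o cone"
      obtain \<beta> where \<beta>: "e \<beta> = S" using \<open>surj e\<close> by (metis surjD)
      \<comment> \<open>\<open>D \<alpha>\<close> swallows the only possible common point with \<open>X \<alpha>\<close> as soon as \<open>\<alpha>\<close> is above \<open>\<beta>\<close>.\<close>
      have "(\<Union>\<alpha>. X \<alpha>) \<inter> body S \<subseteq> (\<lambda>\<alpha>. p \<alpha> S) ` under ?r \<beta>"
      proof
        fix y assume "y \<in> (\<Union>\<alpha>. X \<alpha>) \<inter> body S"
        then obtain \<alpha> where y: "y \<in> X \<alpha>" "y \<in> body S" by blast
        have yA: "y \<in> body S \<inter> body (A \<alpha>)" using y X(1) by blast
        then have "p \<alpha> S \<in> body S \<inter> body (A \<alpha>)" unfolding p_def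
          by (rule someI[where P = "\<lambda>y. y \<in> body S \<inter> body (A \<alpha>)"])
        then have yp: "y = p \<alpha> S" by (rule ordLeq_cone_unique[OF one[rule_format] yA])
        have "y \<notin> D \<alpha>" using y(1) X(1) by blast
        then have "\<beta> \<notin> underS ?r \<alpha>" using yp \<beta> unfolding D_def by blast
        moreover have "total_on UNIV ?r" "refl_on UNIV ?r"
          using card_of_well_order_on[of "UNIV :: (nat \<Rightarrow> bool) set"]
          unfolding well_order_on_def linear_order_on_def partial_order_on_def preorder_on_def
          by auto
        ultimately have "\<alpha> \<in> under ?r \<beta>"
          by (simp add: under_def underS_def total_on_def refl_on_def) metis
        then show "y \<in> (\<lambda>\<alpha>. p \<alpha> S) ` under ?r \<beta>" using yp by blast
      qed
      \<comment> \<open>At most one point per index up to \<open>\<beta>\<close> remains, hence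
        fewer than continuum many, and such a set can be avoided below \<open>S\<close>.\<close>
      then have "|(\<Union>\<alpha>. X \<alpha>) \<inter> body S| \<le>o |under ?r \<beta>|"
        by (rule ordLeq_transitive[OF card_of_mono1 card_of_image])
      moreover have "|under ?r \<beta>| <o ?r"
        by (rule card_of_under_ordLess[OF card_of_Card_order inf]) (simp add: Field_card_of)
      ultimately have "(\<Union>\<alpha>. X \<alpha>) \<inter> body S \<in> tree_ideal \<T>"
        by (intro small_in_tree_ideal) (rule ordLeq_ordLess_trans)
      then obtain R where R: "R \<in> \<T>" "R \<subseteq> S" "((\<Union>\<alpha>. X \<alpha>) \<inter> body S) \<inter> body R = {}"
        using tree_idealD[OF _ S(1)] by meson
      have "body R \<subseteq> body S" using R(2) by (auto simp: body_def)
      then show ?thesis using R by blast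
    qed
    then show "\<exists>S\<in>\<T>. S \<subseteq> T \<and> (\<Union>\<alpha>. X \<alpha>) \<inter> body S = {}" using S(2) by blast
  qed
  moreover have "\<not> (\<Union>\<alpha>. X \<alpha>) \<subseteq> Y" if "Y \<in> F \<alpha>" for \<alpha> Y
    using X(2)[OF that] by (simp add: UN_subset_iff) (rule exI)
  ultimately show ?thesis by (intro bexI[of _ "\<Union>\<alpha>. X \<alpha>"] allI ballI)
qed

theorem theorem13:
  fixes \<T> :: "nat list set set"
  assumes "combinatorial_tree_forcing \<T>"
    and "selective_disjoint_antichain_property \<T>"
  shows "continuum <o cf (cof (tree_ideal \<T>))"
proof -
  interpret tree_forcing \<T> using assms(1) by unfold_locales
  have Field: "Field continuum = UNIV" by (simp add: continuum_eq Field_card_of)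
  obtain A :: "(nat \<Rightarrow> bool) \<Rightarrow> nat list set" where A: "\<forall>\<alpha>. A \<alpha> \<in> \<T>"
    "\<forall>\<alpha> \<beta>. \<alpha> \<noteq> \<beta> \<longrightarrow> body (A \<alpha>) \<inter> body (A \<beta>) = {}"
    "\<forall>T\<in>\<T>. \<exists>S\<in>\<T>. S \<subseteq> T \<and>
      ((\<exists>\<alpha>. S \<subseteq> A \<alpha>) \<or> (\<forall>\<alpha>. |body S \<inter> body (A \<alpha>)| \<le>o cone))"
    using assms(2) unfolding selective_disjoint_antichain_property_def Field by auto
  let ?dom = "\<lambda>J. J \<subseteq> tree_ideal \<T> \<and> (\<forall>X\<in>tree_ideal \<T>. \<exists>Y\<in>J. X \<subseteq> Y)"
  have "?dom (tree_ideal \<T>)" by blast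
  from least_card(1)[of ?dom, OF this]
  obtain J where J: "J \<subseteq> tree_ideal \<T>" "\<forall>X\<in>tree_ideal \<T>. \<exists>Y\<in>J. X \<subseteq> Y"
    and cof: "cof (tree_ideal \<T>) = |J|"
    unfolding cof_def[symmetric] by (elim exE conjE)
  have inf: "infinite (Field |J| )"
    using infinite_cofinal_family[OF J] by (simp add: Field_card_of)
  \<comment> \<open>The cardinal \<open>|J|\<close> is a well-order of \<open>J\<close> itself, so a
    set witnessing its cofinality consists of members of \<open>J\<close>.\<close>
  let ?unb = "\<lambda>B. B \<subseteq> Field |J| \<and> (\<forall>a\<in>Field |J|. \<exists>b\<in>B. (a, b) \<in> |J| )"
  have "?unb (Field |J| )"
    using infinite_Card_order_limit[OF card_of_Card_order inf] by blast
  from least_card(1)[of ?unb, OF this]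
  obtain B where B: "B \<subseteq> J" "\<forall>a\<in>J. \<exists>b\<in>B. (a, b) \<in> |J|" and cf: "cf |J| = |B|"
    unfolding cf_def[symmetric] unfolding Field_card_of by (elim exE conjE)
  have "\<not> |B| \<le>o |UNIV :: (nat \<Rightarrow> bool) set|"
  proof
    assume "|B| \<le>o |UNIV :: (nat \<Rightarrow> bool) set|"
    then obtain h :: "_ \<Rightarrow> nat \<Rightarrow> bool" where h: "inj_on h B"
      unfolding card_of_ordLeq[symmetric] by blast
    \<comment> \<open>\<open>F \<alpha>\<close> is the closed segment of \<open>J\<close> up to the
      element of \<open>B\<close> coded by \<open>\<alpha>\<close>, which is smaller than
      \<open>J\<close>. Indices that code nothing receive the empty family.\<close>
    define F where "F \<alpha> = (if \<alpha> \<in> h ` B then under |J| (inv_into B h \<alpha>) else {})" for \<alpha>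
    have "F \<alpha> \<subseteq> tree_ideal \<T>" for \<alpha>
      using J(1) Field_card_of[of J] by (auto simp: F_def under_def Field_def)
    moreover have "|F \<alpha>| <o cof (tree_ideal \<T>)" for \<alpha>
    proof (cases "\<alpha> \<in> h ` B")
      case True
      then have "inv_into B h \<alpha> \<in> Field |J|"
        using B(1) inv_into_into[of \<alpha> h B] by (auto simp: Field_card_of)
      then show ?thesis
        using card_of_under_ordLess[OF card_of_Card_order inf] True by (simp add: F_def cof)
    next
      case False
      then show ?thesis
        using inf finite_ordLess_infinite_card[of "{}" J] by (simp add: F_def cof Field_card_of)
    qed
    ultimately have "\<exists>X\<in>tree_ideal \<T>. \<forall>\<alpha>. \<forall>Y\<in>F \<alpha>. \<not> X \<subseteq> Y"
      by (intro diagonal_union[of A F] A[rule_format])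
    then obtain X where X: "X \<in> tree_ideal \<T>" "\<forall>\<alpha>. \<forall>Y\<in>F \<alpha>. \<not> X \<subseteq> Y" by blast
    \<comment> \<open>The segments up to elements of \<open>B\<close> exhaust \<open>J\<close>, so a
      member of \<open>J\<close> covering \<open>X\<close> falls into one of the families that
      \<open>X\<close> escapes.\<close>
    obtain Y where Y: "Y \<in> J" "X \<subseteq> Y" using J(2) X(1) by blast
    obtain b where b: "b \<in> B" "(Y, b) \<in> |J|" using B(2) Y(1) by blast
    then have "Y \<in> F (h b)" using h by (simp add: F_def under_def)
    then show False using X(2) Y(2) by blast
  qed
  then have "|UNIV :: (nat \<Rightarrow> bool) set| <o |B|"
    using not_ordLeq_iff_ordLess[OF card_of_Well_order card_of_Well_order] by blast
  then show ?thesis by (simp add: continuum_eq cof cf)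
qed

end
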